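(* Let $\mathcal H,\mathcal K_1,\dots,\mathcal K_m$ be real Hilbert spaces, $f:\mathcal H\to\mathbb R\cup\{+\infty\}$ and $g_j:\mathcal K_j\to\mathbb R\cup\{+\infty\}$ ($j\in[m]$) proper, convex, lower semicontinuous, $L_j:\mathcal H\to\mathcal K_j$ bounded linear, and $\tau,\sigma_1,\dots,\sigma_m>0$. Consider $\min_{u\in\mathcal H}f(u)+\sum_{j=1}^mg_j(L_ju)$. Let $(u_0^k,u_1^k,w_1^k,(s_j^k)_j)_{k}$ be generated by the two-node tree scheme of the context applied to this problem with virtual node operator $A_1\equiv0$ and metrics $M_1=\frac1\tau I$, $N_j=\frac1{\sigma_j}I$. Then, with $u^k:=u_0^k$, the scheme simplifies to the parallel Chambolle--Pock iteration: for all $k\ge1$, $$u^{k+1}=\mathrm{prox}_{\tau f}\Big(u^k-\tau\sum_{j=1}^mL_j^*(2s_j^k-s_j^{k-1})\Big),\qquad s_j^{k+1}=\mathrm{prox}_{\sigma_jg_j^*}\big(s_j^k+\sigma_jL_ju^{k+1}\big),\quad j\in[m].$$ In particular, for $m=1$ this is the standard Chambolle--Pock iteration $u^{k+1}=\mathrm{prox}_{\tau f}(u^k-\tau L_1^*(2s_1^k-s_1^{k-1}))$, $s_1^{k+1}=\mathrm{prox}_{\sigma_1g_1^*}(s_1^k+\sigma_1L_1u^{k+1})$.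
   Context: $[m]=\{1,\dots,m\}$; $g^*$ is the Fenchel conjugate. The tree scheme with two primal nodes (root $0$, single child $1$), all dual variables assigned to the root and all corrections made at node $1$, with $A_0=\partial f$, $A_1\equiv0$, $B_j=\partial g_j$, no parallel sum term ($D_j^{-1}=0$), no cocoercive operators, $a=0$, $b_j=0$, reads: from arbitrary $u_1^0,w_1^0\in\mathcal H$, $s_j^0\in\mathcal K_j$, for $k\ge0$, $0\in\partial f(u_0^{k+1})+M_1(u_0^{k+1}-u_1^k+w_1^k)+\sum_{j=1}^mL_j^*s_j^k$; $0\in\partial g_j^*(s_j^{k+1})+N_j(s_j^{k+1}-s_j^k)-L_ju_0^{k+1}$, $j\in[m]$; $0=w_1^{k+1}-w_1^k+u_1^k-u_0^{k+1}$; $0\in A_1u_1^{k+1}+M_1(u_1^{k+1}-u_0^{k+1}-w_1^{k+1})+\sum_{j=1}^mL_j^*(s_j^{k+1}-s_j^k)$. *)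

theory Defs
  imports "HOL-Analysis.Analysis" "HOL-Library.Extended_Real" "HOL-Library.Set_Algebras"
begin

text \<open>
  A family K_1, ..., K_m of possibly different real Hilbert spaces is represented by closed
  subspaces of one ambient real Hilbert space 'k (for an arbitrary given family, take its
  Hilbert direct sum). The notions below are therefore relative to a closed subspace V. A function
  V -> [-oo,oo] is given by a total function whose values outside V are never used; a
  function on the whole of a Hilbert space is the case V = UNIV.

  If L maps into V, then the library's adjoint of L, restricted to V, is
  the adjoint of L seen as a map into V.
\<close>

definition closed_subspace :: "'a::real_normed_vector set \<Rightarrow> bool" where
  "closed_subspace V \<longleftrightarrow> subspace V \<and> closed V"

definition proper_on :: "'a set \<Rightarrow> ('a \<Rightarrow> ereal) \<Rightarrow> bool" where
  "proper_on V f \<longleftrightarrow> (\<forall>x\<in>V. f x \<noteq> -\<infinity>) \<and> (\<exists>x\<in>V. f x \<noteq> \<infinity>)"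

text \<open>Used together with \<^const>\<open>proper_on\<close> only, so no sum below has the form oo + (-oo).
  Note that 0 * oo = 0 in \<^typ>\<open>ereal\<close>.\<close>

definition ereal_convex_on :: "'a::real_vector set \<Rightarrow> ('a \<Rightarrow> ereal) \<Rightarrow> bool" where
  "ereal_convex_on V f \<longleftrightarrow> convex V \<and>
     (\<forall>x\<in>V. \<forall>y\<in>V. \<forall>a\<ge>0. \<forall>b\<ge>0. a + b = 1 \<longrightarrow>
        f (a *\<^sub>R x + b *\<^sub>R y) \<le> ereal a * f x + ereal b * f y)"

definition lsc_on :: "'a::topological_space set \<Rightarrow> ('a \<Rightarrow> ereal) \<Rightarrow> bool" where
  "lsc_on V f \<longleftrightarrow> (\<forall>x\<in>V. f x \<le> Liminf (at x within V) f)"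

definition fenchel_conjugate_on :: "'a::real_inner set \<Rightarrow> ('a \<Rightarrow> ereal) \<Rightarrow> 'a \<Rightarrow> ereal" where
  "fenchel_conjugate_on V f y = (SUP x\<in>V. ereal (x \<bullet> y) - f x)"

text \<open>Empty, by the usual convention, at points where f is not finite.\<close>

definition subdifferential_on :: "'a::real_inner set \<Rightarrow> ('a \<Rightarrow> ereal) \<Rightarrow> 'a \<Rightarrow> 'a set" where
  "subdifferential_on V f x =
     {v \<in> V. x \<in> V \<and> \<bar>f x\<bar> \<noteq> \<infinity> \<and> (\<forall>y\<in>V. f x + ereal (v \<bullet> (y - x)) \<le> f y)}"

definition prox_on :: "'a::real_inner set \<Rightarrow> ('a \<Rightarrow> ereal) \<Rightarrow> 'a \<Rightarrow> 'a" where
  "prox_on V f x =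
     (THE p. is_arg_min (\<lambda>y. f y + ereal ((norm (y - x))\<^sup>2 / 2)) (\<lambda>y. y \<in> V) p)"

text \<open>
  The two-node tree scheme. The initial data are u1 0, w1 0 and the s j 0; the first
  iterate of the root variable is u0 1, so the value u0 0 is unconstrained.
  A set-valued operator is a function into sets, and v +o S is the translate of the set S by v.
\<close>

definition two_node_tree_scheme ::
  "nat \<Rightarrow> (nat \<Rightarrow> 'k::real_inner set) \<Rightarrow> ('h::real_inner \<Rightarrow> ereal) \<Rightarrow> (nat \<Rightarrow> 'k \<Rightarrow> ereal) \<Rightarrow>
   (nat \<Rightarrow> 'h \<Rightarrow> 'k) \<Rightarrow> ('h \<Rightarrow> 'h set) \<Rightarrow> ('h \<Rightarrow> 'h) \<Rightarrow> (nat \<Rightarrow> 'k \<Rightarrow> 'k) \<Rightarrow>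
   (nat \<Rightarrow> 'h) \<Rightarrow> (nat \<Rightarrow> 'h) \<Rightarrow> (nat \<Rightarrow> 'h) \<Rightarrow> (nat \<Rightarrow> nat \<Rightarrow> 'k) \<Rightarrow> bool" where
  "two_node_tree_scheme m K f g L A1 M1 N u0 u1 w1 s \<longleftrightarrow>
     (\<forall>k. \<forall>j\<in>{1..m}. s j k \<in> K j) \<and>
     (\<forall>k.
       0 \<in> (M1 (u0 (k+1) - u1 k + w1 k) + (\<Sum>j=1..m. adjoint (L j) (s j k)))
             +o subdifferential_on UNIV f (u0 (k+1)) \<and>
       (\<forall>j\<in>{1..m}.
          0 \<in> (N j (s j (k+1) - s j k) - L j (u0 (k+1)))
                +o subdifferential_on (K j) (fenchel_conjugate_on (K j) (g j)) (s j (k+1))) \<and>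
       0 = w1 (k+1) - w1 k + u1 k - u0 (k+1) \<and>
       0 \<in> (M1 (u1 (k+1) - u0 (k+1) - w1 (k+1))
              + (\<Sum>j=1..m. adjoint (L j) (s j (k+1) - s j k)))
             +o A1 (u1 (k+1)))"

end

theory Submission
  imports Defs
begin

text \<open>
  The last inclusion, having $A_1 = 0$, gives
  $u_1^k - w_1^k = u_0^k - \tau \sum_j L_j^* (s_j^k - s_j^{k-1})$ for $k \ge 1$. Substituting this
  into the inclusion for $u_0^{k+1}$ eliminates $u_1$ and $w_1$, and the first two inclusions
  become the optimality conditions of the two proximal steps. Adjoints of bounded operators exist
  by the Riesz representation theorem: the representing vector is the minimiser of
  $\frac12 \|x\|^2 - \varphi(x)$.
\<close>

text \<open>First-order condition: the polynomial has value 0 at \<open>t = 0\<close> and is nowhere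
  smaller, so its slope \<open>b\<close> there vanishes.\<close>

lemma quadratic_linear_nonneg_imp_zero:
  fixes b c :: real
  assumes "\<And>t. 0 \<le> t * b + t\<^sup>2 * c" "0 \<le> c"
  shows "b = 0"
proof (rule ccontr)
  assume "b \<noteq> 0"
  \<comment> \<open>A small step against the slope; the denominator \<open>c + 1\<close> instead of
    \<open>2 * c\<close> stays positive when \<open>c = 0\<close>.\<close>
  let ?t = "- b / (c + 1)"
  have "?t * b + ?t\<^sup>2 * c = - b\<^sup>2 / (c + 1)\<^sup>2"
    using assms(2) by (simp add: divide_simps) (simp add: algebra_simps power2_eq_square)
  moreover have "b\<^sup>2 / (c + 1)\<^sup>2 > 0"
    using \<open>b \<noteq> 0\<close> assms(2) by simp
  ultimately show False
    using assms(1)[of ?t] by simp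
qed

text \<open>A minimising sequence of \<open>J\<close> is Cauchy by the parallelogram law, so
  completeness yields a minimiser \<open>z\<close>. Stationarity of \<open>J\<close> at
  \<open>z\<close> in each direction \<open>x\<close> is the asserted identity.\<close>

theorem riesz_representation:
  fixes \<phi> :: "'a::{real_inner, complete_space} \<Rightarrow> real"
  assumes "bounded_linear \<phi>"
  obtains z where "\<And>x. \<phi> x = x \<bullet> z"
proof -
  interpret bounded_linear \<phi> by fact
  define J where "J x = (norm x)\<^sup>2 / 2 - \<phi> x" for x
  obtain C where C: "\<And>x. norm (\<phi> x) \<le> norm x * C"
    using bounded by blast
  \<comment> \<open>Completing the square: \<open>J x\<close> is at least
    \<open>(norm x - C)\<^sup>2 / 2 - C\<^sup>2 / 2\<close>.\<close>
  have "- (C\<^sup>2 / 2) \<le> J x" for x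
  proof -
    have "\<phi> x \<le> norm x * C"
      using C[of x] by simp
    moreover have "0 \<le> (norm x - C)\<^sup>2" by simp
    ultimately show ?thesis
      by (simp add: J_def power2_eq_square algebra_simps)
  qed
  then have bdd: "bdd_below (range J)" by (auto intro!: bdd_belowI)
  define I where "I = Inf (range J)"
  have I_le: "I \<le> J x" for x
    unfolding I_def by (rule cINF_lower[OF bdd]) simp
  have "\<exists>x. J x < I + 1 / real (Suc n)" for n
    using cINF_less_iff[of UNIV J "I + 1 / real (Suc n)"] bdd by (simp add: I_def)
  then obtain X where X: "\<And>n. J (X n) < I + 1 / real (Suc n)" by metis
  \<comment> \<open>The linear part of \<open>J\<close> cancels at the midpoint. Since
    \<open>J\<close> is at least \<open>I\<close> there, two points with values near
    \<open>I\<close> are close to each other.\<close>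
  have parallelogram: "(dist x y)\<^sup>2 / 4 = J x + J y - 2 * J ((1/2) *\<^sub>R (x + y))" for x y
    by (simp add: J_def dist_norm power2_norm_eq_inner scaleR add inner_diff_left
        inner_diff_right inner_add_left inner_add_right inner_commute field_simps)
  have "Cauchy X"
  proof (rule metric_CauchyI)
    fix e :: real assume "e > 0"
    \<comment> \<open>Each of the two values exceeds \<open>I\<close> by less than
      \<open>e\<^sup>2 / 8\<close>, which makes \<open>e\<^sup>2 / 4\<close> in total, the bound
      that the identity above requires.\<close>
    then obtain M where M: "1 / real (Suc M) < e\<^sup>2 / 8"
      by (metis nat_approx_posE zero_less_divide_iff zero_less_numeral zero_less_power)
    have "dist (X i) (X j) < e" if "i \<ge> M" "j \<ge> M" for i j
    proof -
      have "1 / real (Suc i) \<le> 1 / real (Suc M)" "1 / real (Suc j) \<le> 1 / real (Suc M)"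
        using that by (auto intro!: divide_left_mono)
      then have "(dist (X i) (X j))\<^sup>2 / 4 < e\<^sup>2 / 4"
        using X[of i] X[of j] M I_le[of "(1/2) *\<^sub>R (X i + X j)"]
        unfolding parallelogram by linarith
      then show ?thesis
        using \<open>e > 0\<close> by (simp add: power2_less_imp_less)
    qed
    then show "\<exists>M. \<forall>i\<ge>M. \<forall>j\<ge>M. dist (X i) (X j) < e" by blast
  qed
  then obtain z where z: "X \<longlonglongrightarrow> z"
    using Cauchy_convergent convergent_def by blast
  have "(\<lambda>n. J (X n)) \<longlonglongrightarrow> J z"
    unfolding J_def by (intro tendsto_intros tendsto z) simp
  moreover have "(\<lambda>n. I + 1 / real (Suc n)) \<longlonglongrightarrow> I + 0"
    by (intro tendsto_intros LIMSEQ_Suc lim_1_over_n)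
  ultimately have J_z: "J z \<le> I"
    using X by (auto intro: LIMSEQ_le less_imp_le)
  show ?thesis
  proof
    fix x
    \<comment> \<open>The increment of \<open>J\<close> from its minimiser \<open>z\<close> along
      \<open>x\<close>, a quadratic in \<open>t\<close> whose slope at 0 must vanish.\<close>
    have "0 \<le> t * (x \<bullet> z - \<phi> x) + t\<^sup>2 * ((norm x)\<^sup>2 / 2)" for t
    proof -
      have "J (z + t *\<^sub>R x) - J z = t * (x \<bullet> z - \<phi> x) + t\<^sup>2 * ((norm x)\<^sup>2 / 2)"
        unfolding J_def power2_norm_eq_inner
        by (simp add: scaleR add inner_add_left inner_add_right inner_commute
            power2_eq_square field_simps)
      then show ?thesis
        using J_z I_le[of "z + t *\<^sub>R x"] by linarith
    qed
    then show "\<phi> x = x \<bullet> z"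
      using quadratic_linear_nonneg_imp_zero[of "x \<bullet> z - \<phi> x" "(norm x)\<^sup>2 / 2"] by simp
  qed
qed

text \<open>\<open>adjoint\<close> is a choice of a map with this property, so only existence is at
  stake: for each \<open>y\<close>, Riesz represents the functional sending \<open>x\<close> to
  \<open>T x \<bullet> y\<close>.\<close>

lemma adjoint_works_bounded_linear:
  fixes T :: "'a::{real_inner, complete_space} \<Rightarrow> 'b::real_inner"
  assumes "bounded_linear T"
  shows "x \<bullet> adjoint T y = T x \<bullet> y"
proof -
  have "\<exists>z. \<forall>x. T x \<bullet> y = x \<bullet> z" for y
    by (rule riesz_representation[OF bounded_linear_compose[OF bounded_linear_inner_left assms]])
      blast
  then have "\<exists>T'. \<forall>x y. T x \<bullet> y = x \<bullet> T' y" by metis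
  then show ?thesis
    unfolding adjoint_def by (rule someI2_ex) simp
qed

lemma linear_adjoint_bounded_linear:
  fixes T :: "'a::{real_inner, complete_space} \<Rightarrow> 'b::real_inner"
  assumes "bounded_linear T"
  shows "linear (adjoint T)"
  by (rule linearI; rule vector_eq_ldot[THEN iffD1])
    (simp_all add: adjoint_works_bounded_linear[OF assms] inner_add_right)

text \<open>The assumption is the optimality condition of the proximal problem. The quadratic term
  makes the minimum at \<open>p\<close> strict, and this gives the uniqueness that
  \<open>THE\<close> in \<open>prox_on\<close> demands.\<close>

lemma prox_on_eqI:
  fixes F :: "'a::real_inner \<Rightarrow> ereal"
  assumes "t > 0" and sub: "(1 / t) *\<^sub>R (x - p) \<in> subdifferential_on V F p"
  shows "p = prox_on V (\<lambda>y. ereal t * F y) x"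
proof -
  define \<Phi> where "\<Phi> y = ereal t * F y + ereal ((norm (y - x))\<^sup>2 / 2)" for y
  have "p \<in> V" and "\<bar>F p\<bar> \<noteq> \<infinity>"
    and ineq: "\<And>q. q \<in> V \<Longrightarrow> F p + ereal (((1 / t) *\<^sub>R (x - p)) \<bullet> (q - p)) \<le> F q"
    using sub by (auto simp: subdifferential_on_def)
  then obtain a where a: "F p = ereal a" by auto
  have less: "\<Phi> p < \<Phi> q" if "q \<in> V" "q \<noteq> p" for q
  proof (cases "F q")
    case (real b)
    have "a + ((x - p) \<bullet> (q - p)) / t \<le> b"
      using ineq[OF \<open>q \<in> V\<close>] by (simp add: a real)
    then have "t * a + (x - p) \<bullet> (q - p) \<le> t * b"
      using \<open>t > 0\<close> by (simp add: field_simps)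
    \<comment> \<open>Expanding around \<open>p\<close> produces a cross term that cancels against
      the subgradient term; the surplus \<open>(norm (q - p))\<^sup>2 / 2\<close> gives
      strictness.\<close>
    moreover have "(norm (q - x))\<^sup>2 = (norm (q - p))\<^sup>2 - 2 * ((x - p) \<bullet> (q - p)) + (norm (p - x))\<^sup>2"
      by (simp add: power2_norm_eq_inner algebra_simps inner_commute)
    moreover have "(norm (q - p))\<^sup>2 > 0"
      using \<open>q \<noteq> p\<close> by simp
    ultimately have "t * a + (norm (p - x))\<^sup>2 / 2 < t * b + (norm (q - x))\<^sup>2 / 2"
      by linarith
    then show ?thesis
      by (simp add: \<Phi>_def a real)
  next
    case PInf
    then show ?thesis
      using \<open>t > 0\<close> by (simp add: \<Phi>_def a)
  next
    \<comment> \<open>Vacuous: the subgradient inequality bounds \<open>F q\<close> below by a real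
      number.\<close>
    case MInf
    then show ?thesis
      using ineq[OF \<open>q \<in> V\<close>] by (simp add: a)
  qed
  have "(THE p. is_arg_min \<Phi> (\<lambda>y. y \<in> V) p) = p"
  proof (rule the_equality)
    show "is_arg_min \<Phi> (\<lambda>y. y \<in> V) p"
      using \<open>p \<in> V\<close> less by (auto simp: is_arg_min_def dest: less_asym)
    show "q = p" if "is_arg_min \<Phi> (\<lambda>y. y \<in> V) q" for q
      using that \<open>p \<in> V\<close> less by (auto simp: is_arg_min_def)
  qed
  then show ?thesis
    by (simp add: prox_on_def \<Phi>_def[abs_def])
qed

text \<open>Turns the inclusions of the scheme into membership of an explicit vector in a
  subdifferential, the form that \<open>prox_on_eqI\<close> takes.\<close>

lemma zero_in_elt_set_plus_iff:
  fixes v :: "'a::ab_group_add"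
  shows "0 \<in> v +o S \<longleftrightarrow> - v \<in> S"
  unfolding elt_set_plus_def
  by (auto simp: minus_unique) (metis add.right_inverse)

theorem proposition5p5:
  fixes m :: nat
    and K :: "nat \<Rightarrow> 'k::{real_inner, complete_space} set"
    and f :: "'h::{real_inner, complete_space} \<Rightarrow> ereal"
    and g :: "nat \<Rightarrow> 'k \<Rightarrow> ereal"
    and L :: "nat \<Rightarrow> 'h \<Rightarrow> 'k"
    and \<tau> :: real and \<sigma> :: "nat \<Rightarrow> real"
    and u0 u1 w1 :: "nat \<Rightarrow> 'h" and s :: "nat \<Rightarrow> nat \<Rightarrow> 'k"
  assumes K: "\<And>j. j \<in> {1..m} \<Longrightarrow> closed_subspace (K j)"
    and f: "proper_on UNIV f" "ereal_convex_on UNIV f" "lsc_on UNIV f"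
    and g: "\<And>j. j \<in> {1..m} \<Longrightarrow> proper_on (K j) (g j)"
           "\<And>j. j \<in> {1..m} \<Longrightarrow> ereal_convex_on (K j) (g j)"
           "\<And>j. j \<in> {1..m} \<Longrightarrow> lsc_on (K j) (g j)"
    and L: "\<And>j. j \<in> {1..m} \<Longrightarrow> bounded_linear (L j)"
           "\<And>j. j \<in> {1..m} \<Longrightarrow> range (L j) \<subseteq> K j"
    and \<tau>: "\<tau> > 0"
    and \<sigma>: "\<And>j. j \<in> {1..m} \<Longrightarrow> \<sigma> j > 0"
    and scheme: "two_node_tree_scheme m K f g L (\<lambda>_. {0})
                   (\<lambda>x. (1 / \<tau>) *\<^sub>R x) (\<lambda>j y. (1 / \<sigma> j) *\<^sub>R y) u0 u1 w1 s"
  shows "(\<forall>k\<ge>1.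
            u0 (k+1) = prox_on UNIV (\<lambda>x. ereal \<tau> * f x)
              (u0 k - \<tau> *\<^sub>R (\<Sum>j=1..m. adjoint (L j) (2 *\<^sub>R s j k - s j (k-1)))) \<and>
            (\<forall>j\<in>{1..m}.
               s j (k+1) = prox_on (K j) (\<lambda>y. ereal (\<sigma> j) * fenchel_conjugate_on (K j) (g j) y)
                 (s j k + \<sigma> j *\<^sub>R L j (u0 (k+1)))))
       \<and> (m = 1 \<longrightarrow> (\<forall>k\<ge>1.
            u0 (k+1) = prox_on UNIV (\<lambda>x. ereal \<tau> * f x)
              (u0 k - \<tau> *\<^sub>R adjoint (L 1) (2 *\<^sub>R s 1 k - s 1 (k-1))) \<and>
            s 1 (k+1) = prox_on (K 1) (\<lambda>y. ereal (\<sigma> 1) * fenchel_conjugate_on (K 1) (g 1) y)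
              (s 1 k + \<sigma> 1 *\<^sub>R L 1 (u0 (k+1)))))"
proof -
  define R where "R k = (\<Sum>j=1..m. adjoint (L j) (s j k))" for k
  have lin: "linear (adjoint (L j))" if "j \<in> {1..m}" for j
    by (rule linear_adjoint_bounded_linear[OF L(1)[OF that]])
  have R_diff: "(\<Sum>j=1..m. adjoint (L j) (s j k - s j l)) = R k - R l" for k l
    by (simp add: R_def linear_diff[OF lin] sum_subtractf)
  have R_extrapolate:
    "(\<Sum>j=1..m. adjoint (L j) (2 *\<^sub>R s j k - s j l)) = 2 *\<^sub>R R k - R l" for k l
    by (simp add: R_def linear_diff[OF lin] linear_scale[OF lin] sum_subtractf scaleR_sum_right)
  have root: "- ((1 / \<tau>) *\<^sub>R (u0 (k+1) - u1 k + w1 k) + R k) \<in> subdifferential_on UNIV f (u0 (k+1))"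
    and dual: "j \<in> {1..m} \<Longrightarrow> - ((1 / \<sigma> j) *\<^sub>R (s j (k+1) - s j k) - L j (u0 (k+1)))
      \<in> subdifferential_on (K j) (fenchel_conjugate_on (K j) (g j)) (s j (k+1))"
    and child: "(1 / \<tau>) *\<^sub>R (u1 (k+1) - u0 (k+1) - w1 (k+1)) + (R (k+1) - R k) = 0" for j k
    using scheme unfolding two_node_tree_scheme_def zero_in_elt_set_plus_iff R_diff R_def[symmetric]
    by (blast, blast, metis singletonD minus_zero minus_minus)
  have primal_step: "u0 (k+1) = prox_on UNIV (\<lambda>x. ereal \<tau> * f x)
      (u0 k - \<tau> *\<^sub>R (\<Sum>j=1..m. adjoint (L j) (2 *\<^sub>R s j k - s j (k-1))))"
    if "k \<ge> 1" for k
  proof (rule prox_on_eqI[OF \<tau>])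
    \<comment> \<open>The child equation of the previous round; hence \<open>k \<ge> 1\<close>, as
      \<open>u1 0\<close> and \<open>w1 0\<close> are arbitrary.\<close>
    have "\<tau> *\<^sub>R ((1 / \<tau>) *\<^sub>R (u1 k - u0 k - w1 k) + (R k - R (k-1))) = 0"
      using child[of "k-1"] that by simp
    then have "u1 k - w1 k = u0 k - \<tau> *\<^sub>R (R k - R (k-1))"
      using \<tau> by (simp add: scaleR_add_right algebra_simps)
    \<comment> \<open>The extrapolation arises here: the root inclusion supplies one
      \<open>R k\<close>, and the child's correction supplies \<open>R k - R (k-1)\<close>.\<close>
    then have "- (u0 (k+1) - u1 k + w1 k) - \<tau> *\<^sub>R R k
        = u0 k - \<tau> *\<^sub>R (2 *\<^sub>R R k - R (k-1)) - u0 (k+1)"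
      by (simp add: algebra_simps scaleR_2)
    then have "(1 / \<tau>) *\<^sub>R (u0 k - \<tau> *\<^sub>R (2 *\<^sub>R R k - R (k-1)) - u0 (k+1))
        = (1 / \<tau>) *\<^sub>R (- (u0 (k+1) - u1 k + w1 k) - \<tau> *\<^sub>R R k)"
      by simp
    also have "\<dots> = - ((1 / \<tau>) *\<^sub>R (u0 (k+1) - u1 k + w1 k) + R k)"
      using \<tau> by (simp add: algebra_simps)
    finally show "(1 / \<tau>) *\<^sub>R
        (u0 k - \<tau> *\<^sub>R (\<Sum>j=1..m. adjoint (L j) (2 *\<^sub>R s j k - s j (k-1))) - u0 (k+1))
        \<in> subdifferential_on UNIV f (u0 (k+1))"
      using root[of k] unfolding R_extrapolate by simp
  qed
  have dual_step: "s j (k+1) = prox_on (K j) (\<lambda>y. ereal (\<sigma> j) * fenchel_conjugate_on (K j) (g j) y)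
      (s j k + \<sigma> j *\<^sub>R L j (u0 (k+1)))"
    if "j \<in> {1..m}" for j k
  proof (rule prox_on_eqI[OF \<sigma>[OF that]])
    \<comment> \<open>No iterate before \<open>s j k\<close> enters, so the dual step holds from
      \<open>k = 0\<close> on.\<close>
    have "(1 / \<sigma> j) *\<^sub>R (s j k + \<sigma> j *\<^sub>R L j (u0 (k+1)) - s j (k+1))
        = - ((1 / \<sigma> j) *\<^sub>R (s j (k+1) - s j k) - L j (u0 (k+1)))"
      using \<sigma>[OF that] by (simp add: algebra_simps)
    then show "(1 / \<sigma> j) *\<^sub>R (s j k + \<sigma> j *\<^sub>R L j (u0 (k+1)) - s j (k+1))
        \<in> subdifferential_on (K j) (fenchel_conjugate_on (K j) (g j)) (s j (k+1))"
      using dual[OF that, of k] by simp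
  qed
  \<comment> \<open>For \<open>m = 1\<close> the sum over \<open>j\<close> collapses to the term
    \<open>j = 1\<close>.\<close>
  show ?thesis
    using primal_step dual_step by fastforce
qed

end
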